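(* For each of the following 3-dimensional non-commutative complex associative algebras $D_i$ with basis $\{e_1,e_2,e_3\}$ (products of basis elements not listed are zero), the Nijenhuis operators $N:D_i\to D_i$ are exactly the linear maps listed for $D_i$. Here $\langle u\mid v\mid w\rangle$ denotes the linear map with $e_1\mapsto u$, $e_2\mapsto v$, $e_3\mapsto w$, and all $n_{ij}$ are arbitrary complex numbers subject only to the stated restrictions. (1) $D_1$: $e_1\cdot e_2=\frac12e_3,\ e_2\cdot e_1=-\frac12e_3$. - $N^1=\langle n_{11}e_1+n_{13}e_3\mid n_{21}e_1+n_{22}e_2+n_{23}e_3\mid n_{11}e_3\rangle$; - $N^2=\langle n_{11}e_1+n_{12}e_2+n_{13}e_3\mid n_{22}e_2+n_{23}e_3\mid n_{11}e_3\rangle$, $n_{12}\ne0$; - $N^3=\langle n_{11}e_1+n_{12}e_2+n_{13}e_3\mid n_{21}e_1+(n_{33}-\frac{n_{12}n_{21}}{n_{33}-n_{11}})e_2+n_{23}e_3\mid n_{33}e_3\rangle$, $n_{33}\ne n_{11}$. (2) $D_2$: $e_2\cdot e_1=-e_3$. - $N^1=\langle n_{11}e_1+n_{13}e_3\mid n_{21}e_1+n_{22}e_2+n_{23}e_3\mid n_{22}e_3\rangle$, $n_{21}\ne0$; - $N^2=\langle n_{11}e_1+n_{12}e_2+n_{13}e_3\mid n_{22}e_2+n_{23}e_3\mid n_{11}e_3\rangle$, $n_{12}\ne0$; - $N^3=\langle n_{11}e_1+n_{13}e_3\mid n_{22}e_2+n_{23}e_3\mid n_{22}e_3\rangle$;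 - $N^4=\langle n_{33}e_1+n_{13}e_3\mid n_{22}e_2+n_{23}e_3\mid n_{33}e_3\rangle$, $n_{33}\ne n_{22}$. (3) $D_3$: $e_1\cdot e_1=e_3,\ e_1\cdot e_2=e_3,\ e_2\cdot e_2=\lambda e_3$, where $\lambda\in\mathbb C$, $\lambda\neq0$ is fixed. - $N^1=\langle (n_{33}+\frac{(-1+\sqrt{1-4\lambda})n_{12}}{2})e_1+n_{12}e_2+n_{13}e_3\mid \frac{(-1+\sqrt{1-4\lambda})(n_{22}-n_{33})}{2}e_1+n_{22}e_2+n_{23}e_3\mid n_{33}e_3\rangle$, $n_{12}\ne0$; - $N^2=\langle (n_{33}+\frac{(-1-\sqrt{1-4\lambda})n_{12}}{2})e_1+n_{12}e_2+n_{13}e_3\mid \frac{(-1-\sqrt{1-4\lambda})(n_{22}-n_{33})}{2}e_1+n_{22}e_2+n_{23}e_3\mid n_{33}e_3\rangle$, $n_{12}\ne0$; - $N^3=\langle n_{33}e_1+n_{13}e_3\mid \frac{(-1\pm\sqrt{1-4\lambda})(n_{22}-n_{33})}{2}e_1+n_{22}e_2+n_{23}e_3\mid n_{33}e_3\rangle$ (either sign). (4) $D_4$: $e_3\cdot e_2=e_2,\ e_3\cdot e_3=e_3$. - $N^1=\langle n_{11}e_1\mid n_{22}e_2+n_{23}e_3\mid n_{32}e_2+n_{33}e_3\rangle$; - $N^2=\langle n_{11}e_1\mid n_{22}e_2\mid n_{31}e_1+n_{32}e_2+n_{11}e_3\rangle$, $n_{31}\ne0$; - $N^3=\langle n_{11}e_1\mid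 n_{21}e_1+n_{22}e_2\mid n_{31}e_1+n_{32}e_2+n_{11}e_3\rangle$, $n_{21}\ne0$; - $N^4=\langle n_{11}e_1+n_{12}e_2\mid n_{22}e_2\mid n_{32}e_2+n_{22}e_3\rangle$, $n_{12}\ne0$. (5) $D_5$: $e_2\cdot e_3=e_2,\ e_3\cdot e_3=e_3$. - the same four families $N^1,N^2,N^3,N^4$ (with the same formulas and restrictions) as listed for $D_4$. (6) $D_6$: $e_1\cdot e_1=e_1,\ e_3\cdot e_2=e_2,\ e_3\cdot e_3=e_3$. - $N^1=\langle n_{11}e_1\mid n_{22}e_2+n_{23}e_3\mid n_{32}e_2+n_{33}e_3\rangle$; - $N^2=\langle n_{11}e_1+n_{12}e_2\mid n_{11}e_2\mid n_{32}e_2+n_{11}e_3\rangle$, $n_{12}\ne0$; - $N^3=\langle n_{11}e_1\mid n_{21}e_1+n_{22}e_2+n_{21}e_3\mid n_{31}e_1+n_{32}e_2+(n_{11}+n_{31})e_3\rangle$, $n_{21}\ne0$; - $N^4=\langle n_{11}e_1+n_{13}e_3\mid n_{22}e_2\mid (n_{11}-n_{13})e_3\rangle$, $n_{13}\ne0$; - $N^5=\langle n_{11}e_1\mid n_{22}e_2\mid n_{31}e_1+n_{32}e_2+(n_{11}+n_{31})e_3\rangle$, $n_{31}\ne0$; - $N^6=\langle n_{11}e_1+n_{12}e_2+n_{13}e_3\mid n_{22}e_2\mid \frac{n_{11}n_{12}-n_{12}n_{13}-n_{12}n_{22}}{n_{13}}e_2+(n_{11}-n_{13})e_3\rangle$,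 $n_{12},n_{13}\ne0$. (7) $D_7$: $e_1\cdot e_1=e_1,\ e_2\cdot e_3=e_2,\ e_3\cdot e_3=e_3$. - the same six families $N^1,\dots,N^6$ (with the same formulas and restrictions) as listed for $D_6$. (8) $D_8$: $e_1\cdot e_3=e_1,\ e_3\cdot e_1=e_1,\ e_3\cdot e_2=e_2,\ e_3\cdot e_3=e_3$. - the same four families $N^1,N^2,N^3,N^4$ (with the same formulas and restrictions) as listed for $D_4$. (9) $D_9$: $e_1\cdot e_1=e_1,\ e_1\cdot e_2=e_2\cdot e_1=e_2,\ e_1\cdot e_3=e_3\cdot e_1=e_3,\ e_3\cdot e_2=e_2,\ e_3\cdot e_3=e_3$. - $N^1=\langle n_{11}e_1\mid n_{22}e_2+n_{23}e_3\mid n_{32}e_2+n_{33}e_3\rangle$; - $N^2=\langle (n_{31}+n_{33})e_1\mid n_{22}e_2+n_{23}e_3\mid n_{31}e_1+n_{32}e_2+n_{33}e_3\rangle$, $n_{31}\ne0$; - $N^3=\langle (n_{31}+n_{33})e_1\mid n_{21}e_1+n_{22}e_2-n_{21}e_3\mid n_{31}e_1+n_{32}e_2+n_{33}e_3\rangle$, $n_{21}\ne0$; - $N^4=\langle n_{11}e_1+n_{12}e_2\mid n_{11}e_2\mid n_{32}e_2+n_{11}e_3\rangle$, $n_{12}\ne0$; - $N^5=\langle n_{11}e_1+n_{12}e_2+n_{13}e_3\mid n_{22}e_2\mid \frac{n_{11}n_{12}+n_{12}n_{13}-n_{12}n_{22}}{n_{13}}e_2+(n_{11}+n_{13})e_3\rangle$,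 $n_{13}\ne0$. (10) $D_{10}$: $e_3\cdot e_1=e_1,\ e_3\cdot e_2=e_2,\ e_3\cdot e_3=e_3$. - $N^1$: every linear map. (11) $D_{11}$: $e_1\cdot e_3=e_1,\ e_2\cdot e_3=e_2,\ e_3\cdot e_3=e_3$. - $N^1$: every linear map. (12) $D_{12}$: $e_3\cdot e_1=e_1,\ e_2\cdot e_3=e_2,\ e_3\cdot e_3=e_3$. - $N^1=\langle n_{11}e_1\mid n_{22}e_2\mid n_{31}e_1+n_{32}e_2+n_{33}e_3\rangle$; - $N^2=\langle n_{11}e_1\mid n_{21}e_1+n_{22}e_2\mid n_{31}e_1+n_{32}e_2+n_{11}e_3\rangle$, $n_{21}\ne0$; - $N^3=\langle n_{11}e_1+n_{12}e_2\mid n_{22}e_2\mid n_{31}e_1+n_{32}e_2+n_{22}e_3\rangle$, $n_{12}\ne0$; - $N^4=\langle n_{11}e_1\mid n_{21}e_1+n_{22}e_2+n_{23}e_3\mid \frac{n_{21}n_{33}-n_{11}n_{21}}{n_{23}}e_1+n_{32}e_2+n_{33}e_3\rangle$, $n_{23}\ne0$; - $N^5=\langle n_{11}e_1+n_{12}e_2+n_{13}e_3\mid n_{22}e_2\mid n_{31}e_1+\frac{n_{12}n_{33}-n_{12}n_{22}}{n_{13}}e_2+n_{33}e_3\rangle$, $n_{13}\ne0$.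
   Context: A Nijenhuis operator on an algebra $(A,\cdot)$ over $\mathbb C$ is a linear map $N:A\to A$ such that $N(x)\cdot N(y)=N\big(N(x)\cdot y+x\cdot N(y)-N(x\cdot y)\big)$ for all $x,y\in A$. In item (3), $\sqrt{1-4\lambda}$ denotes a fixed square root of $1-4\lambda$ in $\mathbb C$.
   Formalization: In item (9), family N² is taken with n23 = 0 (so e2 ↦ n22 e2): with n31 ≠ 0 and n23 ≠ 0 the printed map is never Nijenhuis, e.g. N(e1)=e1, N(e2)=e3, N(e3)=e1 fails the identity at (e2,e3). *)

theory Defs
  imports "HOL-Analysis.Analysis"
begin

text \<open>
  A table \<^term>\<open>T\<close> lists the non-zero products of basis vectors of \<open>\<complex>\<^sup>n\<close>:
  \<open>T (i, j) = Some v\<close> stands for \<open>e\<^sub>i \<cdot> e\<^sub>j = v\<close>, and unlisted products are zero.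
\<close>

type_synonym 'n mult_table = "'n \<times> 'n \<rightharpoonup> complex ^ 'n"

definition alg_mult :: "'n::finite mult_table \<Rightarrow> complex ^ 'n \<Rightarrow> complex ^ 'n \<Rightarrow> complex ^ 'n" where
  "alg_mult T x y =
    (\<Sum>i\<in>UNIV. \<Sum>j\<in>UNIV. (x $ i * y $ j) *s (case T (i, j) of None \<Rightarrow> 0 | Some v \<Rightarrow> v))"

text \<open>Linearity is over \<open>\<complex>\<close>; the class-based \<open>linear\<close> would only be \<open>\<real>\<close>-linearity.\<close>

definition nijenhuis_operator ::
    "(complex ^ 'n \<Rightarrow> complex ^ 'n \<Rightarrow> complex ^ 'n) \<Rightarrow> (complex ^ 'n \<Rightarrow> complex ^ 'n) \<Rightarrow> bool" where
  "nijenhuis_operator m N \<longleftrightarrow>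
    Vector_Spaces.linear (*s) (*s) N \<and>
    (\<forall>x y. m (N x) (N y) = N (m (N x) y + m x (N y) - N (m x y)))"

definition nijenhuis_operators :: "'n::finite mult_table \<Rightarrow> (complex ^ 'n \<Rightarrow> complex ^ 'n) set" where
  "nijenhuis_operators T = {N. nijenhuis_operator (alg_mult T) N}"

abbreviation e1 :: "complex ^ 3" where "e1 \<equiv> axis 1 1"
abbreviation e2 :: "complex ^ 3" where "e2 \<equiv> axis 2 1"
abbreviation e3 :: "complex ^ 3" where "e3 \<equiv> axis 3 1"

definition basis_map ::
    "complex ^ 3 \<Rightarrow> complex ^ 3 \<Rightarrow> complex ^ 3 \<Rightarrow> complex ^ 3 \<Rightarrow> complex ^ 3"
    ("\<langle>_ \<mid> _ \<mid> _\<rangle>") where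
  "\<langle>u \<mid> v \<mid> w\<rangle> = (\<lambda>x. x $ 1 *s u + x $ 2 *s v + x $ 3 *s w)"

lemma basis_map_basis:
  "\<langle>u \<mid> v \<mid> w\<rangle> e1 = u" "\<langle>u \<mid> v \<mid> w\<rangle> e2 = v" "\<langle>u \<mid> v \<mid> w\<rangle> e3 = w"
  by (simp_all add: basis_map_def axis_def)

definition D1 :: "3 mult_table" where
  "D1 = [(1,2) \<mapsto> (1/2) *s e3, (2,1) \<mapsto> (- (1/2)) *s e3]"
definition D2 :: "3 mult_table" where
  "D2 = [(2,1) \<mapsto> - e3]"
definition D3 :: "complex \<Rightarrow> 3 mult_table" where
  "D3 l = [(1,1) \<mapsto> e3, (1,2) \<mapsto> e3, (2,2) \<mapsto> l *s e3]"
definition D4 :: "3 mult_table" where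
  "D4 = [(3,2) \<mapsto> e2, (3,3) \<mapsto> e3]"
definition D5 :: "3 mult_table" where
  "D5 = [(2,3) \<mapsto> e2, (3,3) \<mapsto> e3]"
definition D6 :: "3 mult_table" where
  "D6 = [(1,1) \<mapsto> e1, (3,2) \<mapsto> e2, (3,3) \<mapsto> e3]"
definition D7 :: "3 mult_table" where
  "D7 = [(1,1) \<mapsto> e1, (2,3) \<mapsto> e2, (3,3) \<mapsto> e3]"
definition D8 :: "3 mult_table" where
  "D8 = [(1,3) \<mapsto> e1, (3,1) \<mapsto> e1, (3,2) \<mapsto> e2, (3,3) \<mapsto> e3]"
definition D9 :: "3 mult_table" where
  "D9 = [(1,1) \<mapsto> e1, (1,2) \<mapsto> e2, (2,1) \<mapsto> e2, (1,3) \<mapsto> e3, (3,1) \<mapsto> e3,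
         (3,2) \<mapsto> e2, (3,3) \<mapsto> e3]"
definition D10 :: "3 mult_table" where
  "D10 = [(3,1) \<mapsto> e1, (3,2) \<mapsto> e2, (3,3) \<mapsto> e3]"
definition D11 :: "3 mult_table" where
  "D11 = [(1,3) \<mapsto> e1, (2,3) \<mapsto> e2, (3,3) \<mapsto> e3]"
definition D12 :: "3 mult_table" where
  "D12 = [(3,1) \<mapsto> e1, (2,3) \<mapsto> e2, (3,3) \<mapsto> e3]"

lemmas D_defs = D1_def D2_def D3_def D4_def D5_def D6_def D7_def D8_def D9_def D10_def D11_def D12_def

lemma index_3_distinct [simp]:
  "(1::3) \<noteq> 2" "(2::3) \<noteq> 1" "(1::3) \<noteq> 3" "(3::3) \<noteq> 1" "(2::3) \<noteq> 3" "(3::3) \<noteq> 2"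
  by simp_all

lemma alg_mult_assoc:
  assumes "T \<in> {D1, D2, D3 l, D4, D5, D6, D7, D8, D9, D10, D11, D12}"
  shows "alg_mult T (alg_mult T x y) z = alg_mult T x (alg_mult T y z)"
  using assms
  by (elim insertE emptyE;
      simp add: alg_mult_def D_defs sum_3 vec_eq_iff forall_3 axis_def algebra_simps)

lemma alg_mult_not_commutative:
  assumes "T \<in> {D1, D2, D3 l, D4, D5, D6, D7, D8, D9, D10, D11, D12}"
  shows "\<exists>x y. alg_mult T x y \<noteq> alg_mult T y x"
proof -
  have "alg_mult T e1 e2 \<noteq> alg_mult T e2 e1 \<or> alg_mult T e2 e3 \<noteq> alg_mult T e3 e2"
    using assms
    by (elim insertE emptyE;
        simp add: alg_mult_def D_defs sum_3 vec_eq_iff forall_3 axis_def)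
  then show ?thesis by blast
qed

definition families_D1 :: "(complex ^ 3 \<Rightarrow> complex ^ 3) set" where
  "families_D1 =
    {\<langle>n11 *s e1 + n13 *s e3 \<mid> n21 *s e1 + n22 *s e2 + n23 *s e3 \<mid> n11 *s e3\<rangle>
      | n11 n13 n21 n22 n23. True}
  \<union> {\<langle>n11 *s e1 + n12 *s e2 + n13 *s e3 \<mid> n22 *s e2 + n23 *s e3 \<mid> n11 *s e3\<rangle>
      | n11 n12 n13 n22 n23. n12 \<noteq> 0}
  \<union> {\<langle>n11 *s e1 + n12 *s e2 + n13 *s e3
        \<mid> n21 *s e1 + (n33 - n12 * n21 / (n33 - n11)) *s e2 + n23 *s e3 \<mid> n33 *s e3\<rangle>
      | n11 n12 n13 n21 n23 n33. n33 \<noteq> n11}"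

definition families_D2 :: "(complex ^ 3 \<Rightarrow> complex ^ 3) set" where
  "families_D2 =
    {\<langle>n11 *s e1 + n13 *s e3 \<mid> n21 *s e1 + n22 *s e2 + n23 *s e3 \<mid> n22 *s e3\<rangle>
      | n11 n13 n21 n22 n23. n21 \<noteq> 0}
  \<union> {\<langle>n11 *s e1 + n12 *s e2 + n13 *s e3 \<mid> n22 *s e2 + n23 *s e3 \<mid> n11 *s e3\<rangle>
      | n11 n12 n13 n22 n23. n12 \<noteq> 0}
  \<union> {\<langle>n11 *s e1 + n13 *s e3 \<mid> n22 *s e2 + n23 *s e3 \<mid> n22 *s e3\<rangle>
      | n11 n13 n22 n23. True}
  \<union> {\<langle>n33 *s e1 + n13 *s e3 \<mid> n22 *s e2 + n23 *s e3 \<mid> n33 *s e3\<rangle>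
      | n13 n22 n23 n33. n33 \<noteq> n22}"

text \<open>The argument \<open>s\<close> is the chosen square root of \<open>1 - 4\<lambda>\<close>.\<close>

definition families_D3 :: "complex \<Rightarrow> (complex ^ 3 \<Rightarrow> complex ^ 3) set" where
  "families_D3 s =
    {\<langle>(n33 + (-1 + s) * n12 / 2) *s e1 + n12 *s e2 + n13 *s e3
        \<mid> ((-1 + s) * (n22 - n33) / 2) *s e1 + n22 *s e2 + n23 *s e3 \<mid> n33 *s e3\<rangle>
      | n12 n13 n22 n23 n33. n12 \<noteq> 0}
  \<union> {\<langle>(n33 + (-1 - s) * n12 / 2) *s e1 + n12 *s e2 + n13 *s e3
        \<mid> ((-1 - s) * (n22 - n33) / 2) *s e1 + n22 *s e2 + n23 *s e3 \<mid> n33 *s e3\<rangle>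
      | n12 n13 n22 n23 n33. n12 \<noteq> 0}
  \<union> {\<langle>n33 *s e1 + n13 *s e3
        \<mid> ((-1 + s) * (n22 - n33) / 2) *s e1 + n22 *s e2 + n23 *s e3 \<mid> n33 *s e3\<rangle>
      | n13 n22 n23 n33. True}
  \<union> {\<langle>n33 *s e1 + n13 *s e3
        \<mid> ((-1 - s) * (n22 - n33) / 2) *s e1 + n22 *s e2 + n23 *s e3 \<mid> n33 *s e3\<rangle>
      | n13 n22 n23 n33. True}"

definition families_D4 :: "(complex ^ 3 \<Rightarrow> complex ^ 3) set" where
  "families_D4 =
    {\<langle>n11 *s e1 \<mid> n22 *s e2 + n23 *s e3 \<mid> n32 *s e2 + n33 *s e3\<rangle>
      | n11 n22 n23 n32 n33. True}
  \<union> {\<langle>n11 *s e1 \<mid> n22 *s e2 \<mid> n31 *s e1 + n32 *s e2 + n11 *s e3\<rangle>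
      | n11 n22 n31 n32. n31 \<noteq> 0}
  \<union> {\<langle>n11 *s e1 \<mid> n21 *s e1 + n22 *s e2 \<mid> n31 *s e1 + n32 *s e2 + n11 *s e3\<rangle>
      | n11 n21 n22 n31 n32. n21 \<noteq> 0}
  \<union> {\<langle>n11 *s e1 + n12 *s e2 \<mid> n22 *s e2 \<mid> n32 *s e2 + n22 *s e3\<rangle>
      | n11 n12 n22 n32. n12 \<noteq> 0}"

definition families_D6 :: "(complex ^ 3 \<Rightarrow> complex ^ 3) set" where
  "families_D6 =
    {\<langle>n11 *s e1 \<mid> n22 *s e2 + n23 *s e3 \<mid> n32 *s e2 + n33 *s e3\<rangle>
      | n11 n22 n23 n32 n33. True}
  \<union> {\<langle>n11 *s e1 + n12 *s e2 \<mid> n11 *s e2 \<mid> n32 *s e2 + n11 *s e3\<rangle>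
      | n11 n12 n32. n12 \<noteq> 0}
  \<union> {\<langle>n11 *s e1 \<mid> n21 *s e1 + n22 *s e2 + n21 *s e3
        \<mid> n31 *s e1 + n32 *s e2 + (n11 + n31) *s e3\<rangle>
      | n11 n21 n22 n31 n32. n21 \<noteq> 0}
  \<union> {\<langle>n11 *s e1 + n13 *s e3 \<mid> n22 *s e2 \<mid> (n11 - n13) *s e3\<rangle>
      | n11 n13 n22. n13 \<noteq> 0}
  \<union> {\<langle>n11 *s e1 \<mid> n22 *s e2 \<mid> n31 *s e1 + n32 *s e2 + (n11 + n31) *s e3\<rangle>
      | n11 n22 n31 n32. n31 \<noteq> 0}
  \<union> {\<langle>n11 *s e1 + n12 *s e2 + n13 *s e3 \<mid> n22 *s e2
        \<mid> ((n11 * n12 - n12 * n13 - n12 * n22) / n13) *s e2 + (n11 - n13) *s e3\<rangle>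
      | n11 n12 n13 n22. n12 \<noteq> 0 \<and> n13 \<noteq> 0}"

text \<open>
  Correction of a misprint: in the second family the source has
  \<open>e\<^sub>2 \<mapsto> n\<^sub>2\<^sub>2 e\<^sub>2 + n\<^sub>2\<^sub>3 e\<^sub>3\<close> with \<open>n\<^sub>2\<^sub>3\<close> arbitrary. For \<open>n\<^sub>2\<^sub>3 \<noteq> 0\<close> such a map
  is never a Nijenhuis operator (lemma \<open>D9_printed_family\<close> below),
  so the term \<open>n\<^sub>2\<^sub>3 e\<^sub>3\<close> is omitted here.
\<close>

definition families_D9 :: "(complex ^ 3 \<Rightarrow> complex ^ 3) set" where
  "families_D9 =
    {\<langle>n11 *s e1 \<mid> n22 *s e2 + n23 *s e3 \<mid> n32 *s e2 + n33 *s e3\<rangle>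
      | n11 n22 n23 n32 n33. True}
  \<union> {\<langle>(n31 + n33) *s e1 \<mid> n22 *s e2 \<mid> n31 *s e1 + n32 *s e2 + n33 *s e3\<rangle>
      | n22 n31 n32 n33. n31 \<noteq> 0}
  \<union> {\<langle>(n31 + n33) *s e1 \<mid> n21 *s e1 + n22 *s e2 - n21 *s e3
        \<mid> n31 *s e1 + n32 *s e2 + n33 *s e3\<rangle>
      | n21 n22 n31 n32 n33. n21 \<noteq> 0}
  \<union> {\<langle>n11 *s e1 + n12 *s e2 \<mid> n11 *s e2 \<mid> n32 *s e2 + n11 *s e3\<rangle>
      | n11 n12 n32. n12 \<noteq> 0}
  \<union> {\<langle>n11 *s e1 + n12 *s e2 + n13 *s e3 \<mid> n22 *s e2
        \<mid> ((n11 * n12 + n12 * n13 - n12 * n22) / n13) *s e2 + (n11 + n13) *s e3\<rangle>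
      | n11 n12 n13 n22. n13 \<noteq> 0}"

lemma D9_printed_family:
  assumes "n31 \<noteq> 0" and "n23 \<noteq> 0"
  shows "\<langle>(n31 + n33) *s e1 \<mid> n22 *s e2 + n23 *s e3 \<mid> n31 *s e1 + n32 *s e2 + n33 *s e3\<rangle>
         \<notin> nijenhuis_operators D9" (is "?N \<notin> _")
proof
  assume "?N \<in> nijenhuis_operators D9"
  then have "alg_mult D9 (?N e2) (?N e3) =
      ?N (alg_mult D9 (?N e2) e3 + alg_mult D9 e2 (?N e3) - ?N (alg_mult D9 e2 e3))"
    unfolding nijenhuis_operators_def nijenhuis_operator_def by blast
  then have "n31 * n23 = 0"
    by (simp add: alg_mult_def D9_def basis_map_def sum_3 vec_eq_iff forall_3 axis_def algebra_simps)
  with assms show False by simp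
qed

definition families_D12 :: "(complex ^ 3 \<Rightarrow> complex ^ 3) set" where
  "families_D12 =
    {\<langle>n11 *s e1 \<mid> n22 *s e2 \<mid> n31 *s e1 + n32 *s e2 + n33 *s e3\<rangle>
      | n11 n22 n31 n32 n33. True}
  \<union> {\<langle>n11 *s e1 \<mid> n21 *s e1 + n22 *s e2 \<mid> n31 *s e1 + n32 *s e2 + n11 *s e3\<rangle>
      | n11 n21 n22 n31 n32. n21 \<noteq> 0}
  \<union> {\<langle>n11 *s e1 + n12 *s e2 \<mid> n22 *s e2 \<mid> n31 *s e1 + n32 *s e2 + n22 *s e3\<rangle>
      | n11 n12 n22 n31 n32. n12 \<noteq> 0}
  \<union> {\<langle>n11 *s e1 \<mid> n21 *s e1 + n22 *s e2 + n23 *s e3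
        \<mid> ((n21 * n33 - n11 * n21) / n23) *s e1 + n32 *s e2 + n33 *s e3\<rangle>
      | n11 n21 n22 n23 n32 n33. n23 \<noteq> 0}
  \<union> {\<langle>n11 *s e1 + n12 *s e2 + n13 *s e3 \<mid> n22 *s e2
        \<mid> n31 *s e1 + ((n12 * n33 - n12 * n22) / n13) *s e2 + n33 *s e3\<rangle>
      | n11 n12 n13 n22 n31 n33. n13 \<noteq> 0}"

end

theory Submission
  imports Defs
begin

text \<open>
  By bilinearity the Nijenhuis condition need only be tested on pairs of basis vectors, where it
  becomes a system of quadratic equations in the nine matrix entries. Most of these are products of
  linear forms, so a case distinction on which entries vanish yields the families. For \<open>D\<^sub>3\<close> the equations factor through the two roots of
  \<open>t\<^sup>2 + t + \<lambda>\<close>, namely \<open>(-1 \<plusminus> \<surd>(1 - 4\<lambda>)) / 2\<close>.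
  The condition is symmetric under passing to the opposite algebra, so \<open>D\<^sub>5\<close>, \<open>D\<^sub>7\<close>, \<open>D\<^sub>1\<^sub>1\<close>
  reduce to \<open>D\<^sub>4\<close>, \<open>D\<^sub>6\<close>, \<open>D\<^sub>1\<^sub>0\<close>.
\<close>

section \<open>Linear maps and their matrix entries\<close>

lemma linear_basis_map: "Vector_Spaces.linear (*s) (*s) \<langle>u \<mid> v \<mid> w\<rangle>"
  by (intro module_hom_iff_linear[THEN iffD1] module_hom.intro module_hom_axioms.intro vec.module_axioms)
     (simp_all add: basis_map_def vec_eq_iff algebra_simps)

lemma vec_3_expand: "(x :: complex ^ 3) = x $ 1 *s e1 + x $ 2 *s e2 + x $ 3 *s e3"
  by (simp add: vec_eq_iff forall_3 axis_def)

lemma linear_eq_basis_map: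
  assumes "Vector_Spaces.linear (*s) (*s) N"
  shows "N = \<langle>N e1 \<mid> N e2 \<mid> N e3\<rangle>"
proof
  interpret Vector_Spaces.linear "(*s)" "(*s)" N by fact
  show "N x = \<langle>N e1 \<mid> N e2 \<mid> N e3\<rangle> x" for x
    by (subst vec_3_expand[of x]) (simp only: add scale basis_map_def)
qed

lemma basis_map_eq_iff:
  "\<langle>u \<mid> v \<mid> w\<rangle> = \<langle>u' \<mid> v' \<mid> w'\<rangle> \<longleftrightarrow> u = u' \<and> v = v' \<and> w = w'"
  by (metis basis_map_basis)

text \<open>The arguments are the matrix entries row by row: row \<open>k\<close> holds the image of \<open>e\<^sub>k\<close>.\<close>

definition coord_map ::
    "complex \<Rightarrow> complex \<Rightarrow> complex \<Rightarrow> complex \<Rightarrow> complex \<Rightarrow> complex \<Rightarrow> complex \<Rightarrow> complex \<Rightarrow> complex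
      \<Rightarrow> complex ^ 3 \<Rightarrow> complex ^ 3" where
  "coord_map a b c d e f g h i =
    \<langle>a *s e1 + b *s e2 + c *s e3 \<mid> d *s e1 + e *s e2 + f *s e3 \<mid> g *s e1 + h *s e2 + i *s e3\<rangle>"

lemma linear_obtains_coords:
  assumes "Vector_Spaces.linear (*s) (*s) N"
  obtains a b c d e f g h i where "N = coord_map a b c d e f g h i"
  unfolding coord_map_def using linear_eq_basis_map[OF assms] vec_3_expand by metis

lemma linear_coord_map: "Vector_Spaces.linear (*s) (*s) (coord_map a b c d e f g h i)"
  unfolding coord_map_def by (rule linear_basis_map)

section \<open>Reduction of the Nijenhuis condition to pairs of basis vectors\<close>

lemma alg_mult_add:
  "alg_mult T (x + x') y = alg_mult T x y + alg_mult T x' y"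
  "alg_mult T x (y + y') = alg_mult T x y + alg_mult T x y'"
  by (simp_all add: alg_mult_def algebra_simps sum.distrib)

lemma alg_mult_scale:
  "alg_mult T (c *s x) y = c *s alg_mult T x y"
  "alg_mult T x (c *s y) = c *s alg_mult T x y"
  by (simp_all add: alg_mult_def vec.scale_sum_right algebra_simps)

text \<open>The difference of the two sides of the condition (\<open>D\<close> in the proof) is
  bilinear in \<open>x\<close> and \<open>y\<close> because \<open>N\<close> is linear, so it
  vanishes everywhere once it vanishes on basis pairs.\<close>

lemma nijenhuis_iff_on_basis:
  assumes "Vector_Spaces.linear (*s) (*s) N"
  shows "N \<in> nijenhuis_operators T \<longleftrightarrow>
    (\<forall>i j :: 3. let m = alg_mult T; x = axis i 1; y = axis j 1 in
       m (N x) (N y) = N (m (N x) y + m x (N y) - N (m x y)))" (is "_ \<longleftrightarrow> ?R")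
proof
  assume ?R
  interpret Vector_Spaces.linear "(*s)" "(*s)" N by fact
  define D where "D x y = alg_mult T (N x) (N y)
      - N (alg_mult T (N x) y + alg_mult T x (N y) - N (alg_mult T x y))" for x y
  have basis: "D (axis i 1) (axis j 1) = 0" for i j
    using \<open>?R\<close> by (simp add: D_def Let_def)
  have bilinear: "D (x + x') y = D x y + D x' y" "D x (y + y') = D x y + D x y'"
      "D (c *s x) y = c *s D x y" "D x (c *s y) = c *s D x y" for x x' y y' c
    by (simp_all add: D_def alg_mult_add alg_mult_scale add scale diff algebra_simps)
  have "D x y = 0" for x y
    by (subst vec_3_expand[of x], subst vec_3_expand[of y]) (simp add: bilinear basis)
  then show "N \<in> nijenhuis_operators T"
    using assms by (simp add: nijenhuis_operators_def nijenhuis_operator_def D_def)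
qed (simp add: nijenhuis_operators_def nijenhuis_operator_def Let_def)

lemmas nijenhuis_coord_map_iff = nijenhuis_iff_on_basis[OF linear_coord_map]

text \<open>Both sets contain only linear maps, and each of these is a \<open>coord_map\<close>;
  equality of sets thus becomes an equivalence between conditions on nine complex numbers.\<close>

lemma nijenhuis_operators_eqI:
  assumes "\<And>a b c d e f g h i. coord_map a b c d e f g h i \<in> nijenhuis_operators T
      \<longleftrightarrow> coord_map a b c d e f g h i \<in> F"
    and "\<And>N. N \<in> F \<Longrightarrow> Vector_Spaces.linear (*s) (*s) N"
  shows "nijenhuis_operators T = F"
proof (intro set_eqI iffI)
  fix N assume N: "N \<in> nijenhuis_operators T"
  then have "Vector_Spaces.linear (*s) (*s) N"
    by (simp add: nijenhuis_operators_def nijenhuis_operator_def)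
  with N assms(1) show "N \<in> F" by (metis linear_obtains_coords)
next
  fix N assume "N \<in> F"
  with assms show "N \<in> nijenhuis_operators T" by (metis linear_obtains_coords)
qed

section \<open>Opposite algebras\<close>

lemma alg_mult_opposite: "alg_mult (T \<circ> prod.swap) x y = alg_mult T y x"
  unfolding alg_mult_def by (subst sum.swap) (simp add: mult.commute)

lemma nijenhuis_operators_opposite: "nijenhuis_operators (T \<circ> prod.swap) = nijenhuis_operators T"
proof -
  have "nijenhuis_operator (\<lambda>x y. m y x) N \<longleftrightarrow> nijenhuis_operator m N"
    for m :: "complex ^ 'n \<Rightarrow> complex ^ 'n \<Rightarrow> complex ^ 'n" and N
    unfolding nijenhuis_operator_def by (metis add.commute)
  from this[of "alg_mult T"] show ?thesis
    by (simp add: nijenhuis_operators_def alg_mult_opposite[abs_def])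
qed

lemma D_opposite: "D5 = D4 \<circ> prod.swap" "D7 = D6 \<circ> prod.swap" "D11 = D10 \<circ> prod.swap"
  by (simp_all add: D_defs fun_eq_iff forall_3)

section \<open>The Nijenhuis condition as equations in the matrix entries\<close>

lemma coord_map_nth:
  "coord_map a b c d e f g h i x $ 1 = a * x $ 1 + d * x $ 2 + g * x $ 3"
  "coord_map a b c d e f g h i x $ 2 = b * x $ 1 + e * x $ 2 + h * x $ 3"
  "coord_map a b c d e f g h i x $ 3 = c * x $ 1 + f * x $ 2 + i * x $ 3"
  by (simp_all add: coord_map_def basis_map_def axis_def)

text \<open>\<open>D5\<close>, \<open>D7\<close> and \<open>D11\<close> are absent because they are
  handled as opposites.\<close>

lemma alg_mult_D:
  "alg_mult D1 x y = vector [0, 0, (x $ 1 * y $ 2 - x $ 2 * y $ 1) / 2]"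
  "alg_mult D2 x y = vector [0, 0, - (x $ 2 * y $ 1)]"
  "alg_mult (D3 l) x y = vector [0, 0, x $ 1 * y $ 1 + x $ 1 * y $ 2 + l * (x $ 2 * y $ 2)]"
  "alg_mult D4 x y = vector [0, x $ 3 * y $ 2, x $ 3 * y $ 3]"
  "alg_mult D6 x y = vector [x $ 1 * y $ 1, x $ 3 * y $ 2, x $ 3 * y $ 3]"
  "alg_mult D8 x y = vector [x $ 1 * y $ 3 + x $ 3 * y $ 1, x $ 3 * y $ 2, x $ 3 * y $ 3]"
  "alg_mult D9 x y = vector [x $ 1 * y $ 1, x $ 1 * y $ 2 + x $ 2 * y $ 1 + x $ 3 * y $ 2,
    x $ 1 * y $ 3 + x $ 3 * y $ 1 + x $ 3 * y $ 3]"
  "alg_mult D10 x y = vector [x $ 3 * y $ 1, x $ 3 * y $ 2, x $ 3 * y $ 3]"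
  "alg_mult D12 x y = vector [x $ 3 * y $ 1, x $ 2 * y $ 3, x $ 3 * y $ 3]"
  by (simp_all only: alg_mult_def D_defs sum_3 vec_eq_iff forall_3) (simp_all add: axis_def)

lemmas coord_simps = alg_mult_D coord_map_nth vec_eq_iff forall_3 axis_def Let_def

text \<open>In \<open>D1\<close>, \<open>D2\<close> and \<open>D3\<close> products have the form
  B(x,y) \<open>e3\<close>, and \<open>e3\<close> annihilates everything. Pairs involving
  \<open>e3\<close> force \<open>g = h = 0\<close>; the rest then says B((N - i)x, (N - i)y) = 0.
  For \<open>D1\<close> the form B is alternating, so N - i must be singular modulo
  \<open>e3\<close>.\<close>

lemma coord_map_nijenhuis_D1:
  "coord_map a b c d e f g h i \<in> nijenhuis_operators D1 \<longleftrightarrow>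
    g = 0 \<and> h = 0 \<and> (i - a) * (i - e) = b * d"
  unfolding nijenhuis_coord_map_iff
  by (simp add: coord_simps) (auto simp: field_simps; algebra)

lemma coord_map_nijenhuis_D2:
  "coord_map a b c d e f g h i \<in> nijenhuis_operators D2 \<longleftrightarrow>
    g = 0 \<and> h = 0 \<and> (b = 0 \<or> i = a) \<and> (b = 0 \<or> d = 0) \<and> (i = a \<or> i = e) \<and> (d = 0 \<or> i = e)"
  unfolding nijenhuis_coord_map_iff
  by (simp add: coord_simps; cases "b = 0"; cases "d = 0"; cases "g = 0"; cases "h = 0";
      auto simp: algebra_simps; algebra)

text \<open>The last four equations evaluate the form of \<open>D3\<close> on the rows
  \<open>(a - i, b)\<close> and \<open>(d, e - i)\<close> of N - i modulo \<open>e3\<close>. The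
  form has determinant \<open>l\<close>, and its nondegeneracy gives
  \<open>g = h = 0\<close>.\<close>

lemma coord_map_nijenhuis_D3:
  assumes "l \<noteq> 0"
  shows "coord_map a b c d e f g h i \<in> nijenhuis_operators (D3 l) \<longleftrightarrow>
    g = 0 \<and> h = 0 \<and> (a - i)\<^sup>2 + b * (a - i) + l * b\<^sup>2 = 0
      \<and> d\<^sup>2 + d * (e - i) + l * (e - i)\<^sup>2 = 0
      \<and> (a - i) * d + (a - i) * (e - i) + l * b * (e - i) = 0
      \<and> (a - i) * d + b * d + l * b * (e - i) = 0"
  using assms unfolding nijenhuis_coord_map_iff
  by (simp add: coord_simps; cases "g = 0"; cases "h = 0"; auto simp: algebra_simps power2_eq_square)

lemma coord_map_nijenhuis_D4:
  "coord_map a b c d e f g h i \<in> nijenhuis_operators D4 \<longleftrightarrow>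
    c = 0 \<and> (b = 0 \<or> f = 0) \<and> (d = 0 \<or> f = 0) \<and> (f = 0 \<or> g = 0)
      \<and> (b = 0 \<or> d = 0) \<and> (b = 0 \<or> g = 0) \<and> (b = 0 \<or> i = e)
      \<and> (d = 0 \<or> i = a) \<and> (g = 0 \<or> i = a)"
  unfolding nijenhuis_coord_map_iff
  by (simp add: coord_simps; cases "b = 0"; cases "c = 0"; cases "d = 0"; cases "f = 0";
      auto simp: algebra_simps)

lemma coord_map_nijenhuis_D6:
  "coord_map a b c d e f g h i \<in> nijenhuis_operators D6 \<longleftrightarrow>
    (b = 0 \<or> d = 0) \<and> (b = 0 \<or> g = 0) \<and> (c = 0 \<or> d = 0) \<and> (c = 0 \<or> g = 0)
      \<and> (b = 0 \<or> f = 0) \<and> (c = 0 \<or> f = 0)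
      \<and> (d = 0 \<or> f = d) \<and> (g = 0 \<or> f = d) \<and> (d = 0 \<or> i = a + g) \<and> (g = 0 \<or> i = a + g)
      \<and> (c = 0 \<or> i = a - c) \<and> b * (a - c - e) = c * h \<and> b * (i - e) = c * h"
  unfolding nijenhuis_coord_map_iff
  by (simp add: coord_simps; cases "b = 0"; cases "c = 0"; cases "d = 0"; cases "g = 0";
      auto simp: algebra_simps; algebra)

text \<open>The equations agree with those of \<open>D4\<close> for a reason: for fixed N the
  condition is linear in the product, and the product x3 y satisfies it for every linear N. Modulo
  that product, \<open>D4\<close> is -x3 y1 \<open>e1\<close> and \<open>D8\<close> is x1 y3
  \<open>e1\<close>, which are opposite up to sign.\<close>

lemma coord_map_nijenhuis_D8:
  "coord_map a b c d e f g h i \<in> nijenhuis_operators D8 \<longleftrightarrow>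
    c = 0 \<and> (b = 0 \<or> f = 0) \<and> (d = 0 \<or> f = 0) \<and> (f = 0 \<or> g = 0)
      \<and> (b = 0 \<or> d = 0) \<and> (b = 0 \<or> g = 0) \<and> (b = 0 \<or> i = e)
      \<and> (d = 0 \<or> i = a) \<and> (g = 0 \<or> i = a)"
  unfolding nijenhuis_coord_map_iff
  by (simp add: coord_simps; cases "b = 0"; cases "c = 0"; cases "d = 0"; cases "f = 0";
      auto simp: algebra_simps)

text \<open>These are the equations of \<open>D6\<close> with \<open>b\<close>, \<open>c\<close>,
  \<open>d\<close>, \<open>g\<close> negated. Modulo the products x1 y, y1 x and x3 y, which impose
  no condition on a linear N, \<open>D6\<close> is (x1 - x3) y1 \<open>e1\<close> and
  \<open>D9\<close> is -(x1 + x3) y1 \<open>e1\<close>; the substitution of -\<open>e1\<close> for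
  \<open>e1\<close> exchanges the two.\<close>

lemma coord_map_nijenhuis_D9:
  "coord_map a b c d e f g h i \<in> nijenhuis_operators D9 \<longleftrightarrow>
    (b = 0 \<or> d = 0) \<and> (b = 0 \<or> g = 0) \<and> (c = 0 \<or> d = 0) \<and> (c = 0 \<or> g = 0)
      \<and> (b = 0 \<or> f = 0) \<and> (c = 0 \<or> f = 0)
      \<and> (d = 0 \<or> f = - d) \<and> (g = 0 \<or> f = - d) \<and> (d = 0 \<or> a = g + i) \<and> (g = 0 \<or> a = g + i)
      \<and> (c = 0 \<or> i = a + c) \<and> b * (a + c - e) = c * h \<and> b * (i - e) = c * h"
  unfolding nijenhuis_coord_map_iff
  \<comment> \<open>Cancellation of \<open>g\<close> and \<open>c\<close>, supplied as facts so that
    \<open>algebra_simps\<close> expands them in the same way as the equations.\<close>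
  using mult_left_cancel[of g a "g + i"] mult_left_cancel[of c "a + c" i]
  by (simp add: coord_simps; cases "b = 0"; cases "c = 0"; cases "d = 0"; cases "g = 0";
      auto simp: algebra_simps eq_neg_iff_add_eq_0)

text \<open>Exchanging \<open>e1\<close> and \<open>e2\<close> turns \<open>D12\<close> into its
  opposite, hence the symmetry of the system under swapping \<open>a\<close> with \<open>e\<close>,
  \<open>b\<close> with \<open>d\<close>, \<open>c\<close> with \<open>f\<close> and
  \<open>g\<close> with \<open>h\<close>.\<close>

lemma coord_map_nijenhuis_D12:
  "coord_map a b c d e f g h i \<in> nijenhuis_operators D12 \<longleftrightarrow>
    (b = 0 \<or> d = 0) \<and> (c = 0 \<or> d = 0) \<and> (b = 0 \<or> f = 0) \<and> (c = 0 \<or> f = 0)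
      \<and> b * (i - e) = c * h \<and> d * (i - a) = f * g"
  unfolding nijenhuis_coord_map_iff
  by (simp add: coord_simps; cases "b = 0"; cases "c = 0"; cases "d = 0"; cases "f = 0";
      auto simp: algebra_simps)

section \<open>The listed families as conditions on the matrix entries\<close>

lemma coord_map_in_families_D1:
  "coord_map a b c d e f g h i \<in> families_D1 \<longleftrightarrow>
    g = 0 \<and> h = 0 \<and> (b = 0 \<and> i = a \<or> b \<noteq> 0 \<and> d = 0 \<and> i = a \<or> i \<noteq> a \<and> e = i - b * d / (i - a))"
  unfolding families_D1_def coord_map_def Un_iff mem_Collect_eq basis_map_eq_iff
  by (simp add: vec_eq_iff forall_3 axis_def; auto)

lemma coord_map_in_families_D2:
  "coord_map a b c d e f g h i \<in> families_D2 \<longleftrightarrow>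
    g = 0 \<and> h = 0 \<and> (b = 0 \<and> i = e \<and> d \<noteq> 0 \<or> d = 0 \<and> i = a \<and> b \<noteq> 0 \<or> b = 0 \<and> d = 0 \<and> i = e
      \<or> b = 0 \<and> d = 0 \<and> i = a \<and> i \<noteq> e)"
  unfolding families_D2_def coord_map_def Un_iff mem_Collect_eq basis_map_eq_iff
  by (simp add: vec_eq_iff forall_3 axis_def; auto)

text \<open>For each sign, the families with \<open>b = 0\<close> and with
  \<open>b \<noteq> 0\<close> share one formula, which at \<open>b = 0\<close> reads
  \<open>a = i\<close>; this leaves one disjunct per sign.\<close>

lemma coord_map_in_families_D3:
  "coord_map a b c d e f g h i \<in> families_D3 s \<longleftrightarrow>
    g = 0 \<and> h = 0 \<and> ((b \<noteq> 0 \<or> a = i) \<and> a = i + (-1 + s) * b / 2 \<and> d = (-1 + s) * (e - i) / 2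
      \<or> (b \<noteq> 0 \<or> a = i) \<and> a = i + (-1 - s) * b / 2 \<and> d = (-1 - s) * (e - i) / 2)"
  unfolding families_D3_def coord_map_def Un_iff mem_Collect_eq basis_map_eq_iff
  by (simp add: vec_eq_iff forall_3 axis_def; auto)

lemma coord_map_in_families_D4:
  "coord_map a b c d e f g h i \<in> families_D4 \<longleftrightarrow>
    b = 0 \<and> c = 0 \<and> d = 0 \<and> g = 0 \<or> b = 0 \<and> c = 0 \<and> d = 0 \<and> f = 0 \<and> i = a \<and> g \<noteq> 0
    \<or> b = 0 \<and> c = 0 \<and> f = 0 \<and> i = a \<and> d \<noteq> 0 \<or> c = 0 \<and> d = 0 \<and> f = 0 \<and> g = 0 \<and> i = e \<and> b \<noteq> 0"
  unfolding families_D4_def coord_map_def Un_iff mem_Collect_eq basis_map_eq_iff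
  by (simp add: vec_eq_iff forall_3 axis_def; auto)

lemma coord_map_in_families_D6:
  "coord_map a b c d e f g h i \<in> families_D6 \<longleftrightarrow>
    b = 0 \<and> c = 0 \<and> d = 0 \<and> g = 0 \<or> c = 0 \<and> d = 0 \<and> f = 0 \<and> g = 0 \<and> e = a \<and> i = a \<and> b \<noteq> 0
    \<or> b = 0 \<and> c = 0 \<and> f = d \<and> i = a + g \<and> d \<noteq> 0 \<or> b = 0 \<and> d = 0 \<and> f = 0 \<and> g = 0 \<and> h = 0 \<and> i = a - c \<and> c \<noteq> 0
    \<or> b = 0 \<and> c = 0 \<and> d = 0 \<and> f = 0 \<and> i = a + g \<and> g \<noteq> 0
    \<or> d = 0 \<and> f = 0 \<and> g = 0 \<and> h = (a * b - b * c - b * e) / c \<and> i = a - c \<and> b \<noteq> 0 \<and> c \<noteq> 0"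
  unfolding families_D6_def coord_map_def Un_iff mem_Collect_eq basis_map_eq_iff
  by (simp add: vec_eq_iff forall_3 axis_def; auto)

lemma coord_map_in_families_D9:
  "coord_map a b c d e f g h i \<in> families_D9 \<longleftrightarrow>
    b = 0 \<and> c = 0 \<and> d = 0 \<and> g = 0 \<or> b = 0 \<and> c = 0 \<and> d = 0 \<and> f = 0 \<and> a = g + i \<and> g \<noteq> 0
    \<or> b = 0 \<and> c = 0 \<and> f = - d \<and> a = g + i \<and> d \<noteq> 0 \<or> c = 0 \<and> d = 0 \<and> f = 0 \<and> g = 0 \<and> e = a \<and> i = a \<and> b \<noteq> 0
    \<or> d = 0 \<and> f = 0 \<and> g = 0 \<and> h = (a * b + b * c - b * e) / c \<and> i = a + c \<and> c \<noteq> 0"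
  unfolding families_D9_def coord_map_def Un_iff mem_Collect_eq basis_map_eq_iff
  by (simp add: vec_eq_iff forall_3 axis_def; auto)

lemma coord_map_in_families_D12:
  "coord_map a b c d e f g h i \<in> families_D12 \<longleftrightarrow>
    b = 0 \<and> c = 0 \<and> d = 0 \<and> f = 0 \<or> b = 0 \<and> c = 0 \<and> f = 0 \<and> i = a \<and> d \<noteq> 0 \<or> c = 0 \<and> d = 0 \<and> f = 0 \<and> i = e \<and> b \<noteq> 0
    \<or> b = 0 \<and> c = 0 \<and> g = (d * i - a * d) / f \<and> f \<noteq> 0 \<or> d = 0 \<and> f = 0 \<and> h = (b * i - b * e) / c \<and> c \<noteq> 0"
  unfolding families_D12_def coord_map_def Un_iff mem_Collect_eq basis_map_eq_iff
  by (simp add: vec_eq_iff forall_3 axis_def; auto)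

section \<open>Solving the equations\<close>

lemma nijenhuis_operators_D3:
  assumes "l \<noteq> 0" and "s\<^sup>2 = 1 - 4 * l"
  shows "nijenhuis_operators (D3 l) = families_D3 s"
proof (rule nijenhuis_operators_eqI)
  \<comment> \<open>\<open>r\<close> is one root of t^2 + t + l and \<open>- 1 - r\<close> is the
    other. Both \<open>s\<close> and \<open>l\<close> are polynomials in \<open>r\<close>, so only
    polynomial identities remain.\<close>
  define r where "r = (-1 + s) / 2"
  have "r * 2 = s - 1"
    by (simp add: r_def)
  then have s: "s = 2 * r + 1"
    by algebra
  have "4 * l = 4 * (- r * (r + 1))"
    using assms(2) unfolding s by algebra
  then have l: "l = - r * (r + 1)"
    by simp
  fix a b c d e f g h i :: complex
  have roots: "(-1 + s) * x / 2 = r * x" "(-1 - s) * x / 2 = (- 1 - r) * x" for x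
    by (simp_all add: s field_simps)
  define A E where "A = a - i" and "E = e - i"
  have shift: "a = i \<longleftrightarrow> A = 0" "a = i + x \<longleftrightarrow> A = x" for x
    by (auto simp: A_def algebra_simps)
  have "A\<^sup>2 + b * A + l * b\<^sup>2 = 0 \<and> d\<^sup>2 + d * E + l * E\<^sup>2 = 0
      \<and> A * d + A * E + l * b * E = 0 \<and> A * d + b * d + l * b * E = 0
    \<longleftrightarrow> (b \<noteq> 0 \<or> A = 0) \<and> A = r * b \<and> d = r * E
      \<or> (b \<noteq> 0 \<or> A = 0) \<and> A = (- 1 - r) * b \<and> d = (- 1 - r) * E" (is "?L \<longleftrightarrow> ?R")
  proof
    assume ?L
    \<comment> \<open>The first two equations factor through the roots; \<open>A * E = b * d\<close>
      is the difference of the last two.\<close>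
    then have "(A - r * b) * (A - (- 1 - r) * b) = 0" "(d - r * E) * (d - (- 1 - r) * E) = 0"
        "A * E = b * d"
      unfolding l by algebra+
    \<comment> \<open>If \<open>b \<noteq> 0\<close>, then \<open>A * E = b * d\<close> forces the
      same root in both rows. If \<open>b = 0\<close>, then \<open>A = 0\<close>, and the root is
      chosen according to \<open>d\<close>.\<close>
    then show ?R
      by (cases "b = 0") auto
  next
    assume ?R
    then show ?L
      unfolding l by (elim disjE conjE; intro conjI; algebra)
  qed
  then show "coord_map a b c d e f g h i \<in> nijenhuis_operators (D3 l)
      \<longleftrightarrow> coord_map a b c d e f g h i \<in> families_D3 s"
    unfolding coord_map_nijenhuis_D3[OF assms(1)] coord_map_in_families_D3 roots shift
    unfolding A_def[symmetric] E_def[symmetric] by blast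
qed (auto simp: families_D3_def linear_basis_map)

text \<open>The product is x3 y, so N(x (N y)) and N(N(x y)) cancel by linearity, and both sides
  equal (N x)3 N y.\<close>

lemma nijenhuis_operators_D10: "nijenhuis_operators D10 = {N. Vector_Spaces.linear (*s) (*s) N}"
proof (rule nijenhuis_operators_eqI)
  show "coord_map a b c d e f g h i \<in> nijenhuis_operators D10 \<longleftrightarrow>
      coord_map a b c d e f g h i \<in> {N. Vector_Spaces.linear (*s) (*s) N}" for a b c d e f g h i
    unfolding nijenhuis_coord_map_iff by (simp add: coord_simps linear_coord_map algebra_simps)
qed simp

lemma nijenhuis_operators_D1: "nijenhuis_operators D1 = families_D1"
proof (rule nijenhuis_operators_eqI)
  fix a b c d e f g h i :: complex
  have "e = i - b * d / (i - a) \<longleftrightarrow> (i - a) * (i - e) = b * d" if "i \<noteq> a"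
  proof -
    have "e = i - b * d / (i - a) \<longleftrightarrow> b * d / (i - a) = i - e"
      by (auto simp: algebra_simps)
    also have "\<dots> \<longleftrightarrow> (i - a) * (i - e) = b * d"
      using that by (auto simp: nonzero_divide_eq_eq mult.commute)
    finally show ?thesis .
  qed
  then show "coord_map a b c d e f g h i \<in> nijenhuis_operators D1
      \<longleftrightarrow> coord_map a b c d e f g h i \<in> families_D1"
    \<comment> \<open>At \<open>i = a\<close> the equation becomes \<open>b * d = 0\<close>, giving
      the first two families; otherwise it can be solved for \<open>e\<close>.\<close>
    unfolding coord_map_nijenhuis_D1 coord_map_in_families_D1 by (cases "i = a") auto
qed (auto simp: families_D1_def linear_basis_map)

lemma nijenhuis_operators_D2: "nijenhuis_operators D2 = families_D2"
proof (rule nijenhuis_operators_eqI)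
  fix a b c d e f g h i :: complex
  show "coord_map a b c d e f g h i \<in> nijenhuis_operators D2
      \<longleftrightarrow> coord_map a b c d e f g h i \<in> families_D2"
    unfolding coord_map_nijenhuis_D2 coord_map_in_families_D2 by auto
qed (auto simp: families_D2_def linear_basis_map)

lemma nijenhuis_operators_D4: "nijenhuis_operators D4 = families_D4"
proof (rule nijenhuis_operators_eqI)
  fix a b c d e f g h i :: complex
  show "coord_map a b c d e f g h i \<in> nijenhuis_operators D4
      \<longleftrightarrow> coord_map a b c d e f g h i \<in> families_D4"
    unfolding coord_map_nijenhuis_D4 coord_map_in_families_D4 by auto
qed (auto simp: families_D4_def linear_basis_map)

lemma nijenhuis_operators_D6: "nijenhuis_operators D6 = families_D6"
proof (rule nijenhuis_operators_eqI)
  fix a b c d e f g h i :: complex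
  have "h = (a * b - b * c - b * e) / c \<longleftrightarrow> b * (a - c - e) = c * h" if "c \<noteq> 0"
    using that by (auto simp: nonzero_eq_divide_eq algebra_simps)
  then show "coord_map a b c d e f g h i \<in> nijenhuis_operators D6
      \<longleftrightarrow> coord_map a b c d e f g h i \<in> families_D6"
    unfolding coord_map_nijenhuis_D6 coord_map_in_families_D6
    \<comment> \<open>For \<open>c \<noteq> 0\<close> the equations determine \<open>h\<close>, and
      \<open>b\<close> separates the fourth from the sixth family. For \<open>c = 0\<close> and
      \<open>b \<noteq> 0\<close> they force \<open>a = e = i\<close>.\<close>
    by (cases "c = 0"; cases "b = 0") auto
qed (auto simp: families_D6_def linear_basis_map)

lemma nijenhuis_operators_D8: "nijenhuis_operators D8 = families_D4"
proof (rule nijenhuis_operators_eqI)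
  fix a b c d e f g h i :: complex
  show "coord_map a b c d e f g h i \<in> nijenhuis_operators D8
      \<longleftrightarrow> coord_map a b c d e f g h i \<in> families_D4"
    unfolding coord_map_nijenhuis_D8 coord_map_in_families_D4 by auto
qed (auto simp: families_D4_def linear_basis_map)

lemma nijenhuis_operators_D9: "nijenhuis_operators D9 = families_D9"
proof (rule nijenhuis_operators_eqI)
  fix a b c d e f g h i :: complex
  have "h = (a * b + b * c - b * e) / c \<longleftrightarrow> b * (a + c - e) = c * h" if "c \<noteq> 0"
    using that by (auto simp: nonzero_eq_divide_eq algebra_simps)
  then show "coord_map a b c d e f g h i \<in> nijenhuis_operators D9
      \<longleftrightarrow> coord_map a b c d e f g h i \<in> families_D9"
    unfolding coord_map_nijenhuis_D9 coord_map_in_families_D9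
    by (cases "c = 0"; cases "b = 0") auto
qed (auto simp: families_D9_def linear_basis_map)

lemma nijenhuis_operators_D12: "nijenhuis_operators D12 = families_D12"
proof (rule nijenhuis_operators_eqI)
  fix a b c d e f g h i :: complex
  have "h = (b * i - b * e) / c \<longleftrightarrow> b * (i - e) = c * h" if "c \<noteq> 0"
    using that by (auto simp: nonzero_eq_divide_eq algebra_simps)
  moreover have "g = (d * i - a * d) / f \<longleftrightarrow> d * (i - a) = f * g" if "f \<noteq> 0"
    using that by (auto simp: nonzero_eq_divide_eq algebra_simps)
  ultimately show "coord_map a b c d e f g h i \<in> nijenhuis_operators D12
      \<longleftrightarrow> coord_map a b c d e f g h i \<in> families_D12"
    unfolding coord_map_nijenhuis_D12 coord_map_in_families_D12
    by (cases "c = 0"; cases "f = 0") auto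
qed (auto simp: families_D12_def linear_basis_map)

theorem theorem4p2:
  shows "nijenhuis_operators D1 = families_D1
    \<and> nijenhuis_operators D2 = families_D2
    \<and> (\<forall>l s :: complex. l \<noteq> 0 \<longrightarrow> s\<^sup>2 = 1 - 4 * l \<longrightarrow> nijenhuis_operators (D3 l) = families_D3 s)
    \<and> nijenhuis_operators D4 = families_D4
    \<and> nijenhuis_operators D5 = families_D4
    \<and> nijenhuis_operators D6 = families_D6
    \<and> nijenhuis_operators D7 = families_D6
    \<and> nijenhuis_operators D8 = families_D4
    \<and> nijenhuis_operators D9 = families_D9
    \<and> nijenhuis_operators D10 = {N. Vector_Spaces.linear (*s) (*s) N}
    \<and> nijenhuis_operators D11 = {N. Vector_Spaces.linear (*s) (*s) N}
    \<and> nijenhuis_operators D12 = families_D12"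
  using nijenhuis_operators_D3
  by (simp add: nijenhuis_operators_D1 nijenhuis_operators_D2 nijenhuis_operators_D4
      nijenhuis_operators_D6 nijenhuis_operators_D8 nijenhuis_operators_D9 nijenhuis_operators_D10
      nijenhuis_operators_D12 D_opposite nijenhuis_operators_opposite)

end
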